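(* Let $(G,<,\mathbf{q})$ be an instance of the stable assignment problem, with $G=(A\cup B,E)$. There exists a unique set $\mathcal{L}\subseteq \mathcal{M}(G,\mathbf{q})$ that has the legal property. Moreover, there is a subgraph $G_L$ of $G$ (on the same vertex set) such that $\mathcal{L}=\mathcal{S}(G_L,<,\mathbf{q})$, and $$E(G_L)=\bigcup\{M: M\in \mathcal{S}(G_L,<,\mathbf{q})\}=\bigcup\{M: M\in \mathcal{L}\}.$$
   Context: A stable assignment instance is a triple $(G,<,\mathbf{q})$, where $G=(A\cup B,E)$ is a finite simple bipartite graph with bipartition $(A,B)$ (elements of $A$ are students, elements of $B$ are schools), $<=\{<_v\}_{v\in A\cup B}$ with $<_v$ a strict total order on the neighbours of $v$ in $G$ (write $y>_x y'$ if $x$ strictly prefers $y$ to $y'$, $y\ge_x y'$ if $y>_x y'$ or $y=y'$, and $y>_x\emptyset$ for every neighbour $y$ of $x$), and $\mathbf{q}=(q_b)_{b\in B}$ is a vector of positive integers (quotas). An assignment is a set $M\subseteq E$ such that each student is incident to at most one edge of $M$ and each school $b$ to at most $q_b$ edges of $M$; write $M(x)=\{y: xy\in M\}$, and for a student $a$ identify $M(a)$ with its unique element, or $\emptyset$ if $a$ is unmatched. An edge $ab\in E$ ($a\in A$, $b\in B$) blocks $M$ if $b>_a M(a)$ and either $|M(b)|<q_b$ or $a>_b a'$ for some $a'\in M(b)$. An assignment $M'$ blocks $M$ if some edge of $M'$ blocks $M$. $M$ is stable if no edge of $E$ blocks it. $\mathcal{M}(G,\mathbf{q})$ and $\mathcal{S}(G,<,\mathbf{q})$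 denote the sets of all assignments and of stable assignments. A set $\mathcal{L}\subseteq\mathcal{M}(G,\mathbf{q})$ has the legal property if the set of assignments that are blocked by some assignment in $\mathcal{L}$ is exactly $\mathcal{M}(G,\mathbf{q})\setminus\mathcal{L}$. For a subgraph $G'$ of $G$ on the same vertex set, $(G',<,\mathbf{q})$ denotes the instance whose preference orders are those induced by $<$ on $G'$ and whose quotas are $\mathbf{q}$. *)

theory Defs
  imports Main
begin

text \<open>
  Students and schools live in different types, so the two sides of the bipartition are
  disjoint; the edge joining student \<open>a\<close> and school \<open>b\<close> is the pair \<open>(a, b)\<close>.
  A pair \<open>(y', y) \<in> student_less I x\<close> means that \<open>x\<close> strictly prefers \<open>y\<close> to \<open>y'\<close>,
  and likewise for \<open>school_less\<close>.
\<close>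

record ('a, 'b) assignment_instance =
  students :: "'a set"
  schools :: "'b set"
  edges :: "('a \<times> 'b) set"
  student_less :: "'a \<Rightarrow> ('b \<times> 'b) set"
  school_less :: "'b \<Rightarrow> ('a \<times> 'a) set"
  quota :: "'b \<Rightarrow> nat"

text \<open>
  For an assignment \<open>M\<close> these are the sets \<open>M(a)\<close> and \<open>M(b)\<close>; for \<open>M = edges I\<close> they are
  the neighbourhoods of \<open>a\<close> and \<open>b\<close>.
\<close>

definition schools_of :: "('a \<times> 'b) set \<Rightarrow> 'a \<Rightarrow> 'b set" where
  "schools_of M a = {b. (a, b) \<in> M}"

definition students_of :: "('a \<times> 'b) set \<Rightarrow> 'b \<Rightarrow> 'a set" where
  "students_of M b = {a. (a, b) \<in> M}"

definition strict_total_order_of :: "'c set \<Rightarrow> ('c \<times> 'c) set \<Rightarrow> bool" where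
  "strict_total_order_of N r \<longleftrightarrow> r \<subseteq> N \<times> N \<and> strict_linear_order_on N r"

definition stable_assignment_instance :: "('a, 'b) assignment_instance \<Rightarrow> bool" where
  "stable_assignment_instance I \<longleftrightarrow>
     finite (students I) \<and> finite (schools I) \<and>
     edges I \<subseteq> students I \<times> schools I \<and>
     (\<forall>a\<in>students I. strict_total_order_of (schools_of (edges I) a) (student_less I a)) \<and>
     (\<forall>b\<in>schools I. strict_total_order_of (students_of (edges I) b) (school_less I b)) \<and>
     (\<forall>b\<in>schools I. 0 < quota I b)"

definition assignments :: "('a, 'b) assignment_instance \<Rightarrow> ('a \<times> 'b) set set" where
  "assignments I = {M. M \<subseteq> edges I \<and>
     (\<forall>a\<in>students I. card (schools_of M a) \<le> 1) \<and>
     (\<forall>b\<in>schools I. card (students_of M b) \<le> quota I b)}"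

text \<open>The first disjunct is the convention that \<open>a\<close> prefers every neighbour to being unmatched.\<close>

definition prefers_to_assigned ::
  "('a, 'b) assignment_instance \<Rightarrow> 'a \<Rightarrow> 'b \<Rightarrow> ('a \<times> 'b) set \<Rightarrow> bool" where
  "prefers_to_assigned I a b M \<longleftrightarrow>
     schools_of M a = {} \<or> (\<exists>b'. schools_of M a = {b'} \<and> (b', b) \<in> student_less I a)"

definition edge_blocks ::
  "('a, 'b) assignment_instance \<Rightarrow> 'a \<times> 'b \<Rightarrow> ('a \<times> 'b) set \<Rightarrow> bool" where
  "edge_blocks I e M \<longleftrightarrow> (case e of (a, b) \<Rightarrow>
     (a, b) \<in> edges I \<and> prefers_to_assigned I a b M \<and>
     (card (students_of M b) < quota I b \<or> (\<exists>a'\<in>students_of M b. (a', a) \<in> school_less I b)))"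

definition assignment_blocks ::
  "('a, 'b) assignment_instance \<Rightarrow> ('a \<times> 'b) set \<Rightarrow> ('a \<times> 'b) set \<Rightarrow> bool" where
  "assignment_blocks I M' M \<longleftrightarrow> (\<exists>e\<in>M'. edge_blocks I e M)"

definition stable_assignments :: "('a, 'b) assignment_instance \<Rightarrow> ('a \<times> 'b) set set" where
  "stable_assignments I = {M \<in> assignments I. \<not> (\<exists>e\<in>edges I. edge_blocks I e M)}"

definition legal_property ::
  "('a, 'b) assignment_instance \<Rightarrow> ('a \<times> 'b) set set \<Rightarrow> bool" where
  "legal_property I L \<longleftrightarrow> L \<subseteq> assignments I \<and>
     {M \<in> assignments I. \<exists>M'\<in>L. assignment_blocks I M' M} = assignments I - L"

text \<open>
  The instance on the subgraph with the same vertices and edge set \<open>E'\<close>, with the induced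
  preference orders.
\<close>

definition subgraph_instance ::
  "('a, 'b) assignment_instance \<Rightarrow> ('a \<times> 'b) set \<Rightarrow> ('a, 'b) assignment_instance" where
  "subgraph_instance I E' = I\<lparr>edges := E',
     student_less := (\<lambda>a. Restr (student_less I a) (schools_of E' a)),
     school_less := (\<lambda>b. Restr (school_less I b) (students_of E' b))\<rparr>"

lemma strict_total_order_of_Restr:
  assumes "strict_total_order_of N r" and "N' \<subseteq> N"
  shows "strict_total_order_of N' (Restr r N')"
  using assms
  unfolding strict_total_order_of_def strict_linear_order_on_def total_on_def irrefl_def trans_def
  by blast

lemma stable_assignment_instance_subgraph:
  assumes "stable_assignment_instance I" and "E' \<subseteq> edges I"
  shows "stable_assignment_instance (subgraph_instance I E')"
proof -
  have "schools_of E' a \<subseteq> schools_of (edges I) a" "students_of E' b \<subseteq> students_of (edges I) b" for a b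
    using assms(2) by (auto simp: schools_of_def students_of_def)
  then show ?thesis
    using assms unfolding stable_assignment_instance_def subgraph_instance_def
    by simp (blast intro: strict_total_order_of_Restr)
qed

end

theory Submission
  imports Defs
begin

text \<open>
  Let \<open>F E\<close> be the union of all assignments that no edge of \<open>E\<close> blocks. A set \<open>\<L>\<close> is legal iff
  it consists of the assignments not blocked by \<open>\<Union>\<L>\<close>, so legal sets correspond to fixed points
  of the antitone map \<open>F\<close>. The least fixed point \<open>X\<close> of \<open>F \<circ> F\<close> and \<open>Y = F X\<close> satisfy
  \<open>F Y = X \<subseteq> Y\<close>, and every fixed point of \<open>F\<close> lies between them; it remains to see \<open>X = Y\<close>.
  Here \<open>X\<close> is the union of the stable assignments of the subgraph \<open>Y\<close>, and neither of
  an assignment unblocked by \<open>X\<close> and one unblocked by \<open>Y\<close> blocks the other. This makes it possible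
  to rotate a stable assignment of \<open>Y\<close> upwards as long as some edge of \<open>Y\<close> is better for its
  student, and downwards as long as some edge of \<open>Y\<close> is worse for its student. Moving from the top
  downwards, no edge of \<open>Y\<close> is skipped, so each of them lies in a stable assignment of \<open>Y\<close>,
  that is, in \<open>X\<close>.
\<close>

section \<open>Extremal elements of finite sets and cycles of self-maps\<close>

lemma finite_obtain_maximizer:
  fixes f :: "'c \<Rightarrow> nat"
  assumes "finite S" "S \<noteq> {}"
  obtains x where "x \<in> S" "\<And>y. y \<in> S \<Longrightarrow> f y \<le> f x"
proof -
  have "Max (f ` S) \<in> f ` S" using assms by simp
  then obtain x where "x \<in> S" "f x = Max (f ` S)" by force
  then show thesis using that assms(1) by simp
qed

lemma finite_obtain_greatest:
  assumes "finite S" "S \<noteq> {}" "trans r" "\<And>x y. x \<in> S \<Longrightarrow> y \<in> S \<Longrightarrow> x = y \<or> (x, y) \<in> r \<or> (y, x) \<in> r"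
  obtains m where "m \<in> S" "\<And>x. x \<in> S \<Longrightarrow> x = m \<or> (x, m) \<in> r"
proof -
  have "\<exists>m\<in>S. \<forall>x\<in>S. x = m \<or> (x, m) \<in> r"
    using assms(1,2,4)
  proof (induction S rule: finite_ne_induct)
    case (insert x F)
    then obtain m where m: "m \<in> F" "\<forall>x\<in>F. x = m \<or> (x, m) \<in> r" by (metis insertCI)
    have "x = m \<or> (x, m) \<in> r \<or> (m, x) \<in> r" using insert.prems m(1) by simp
    then show ?case using m transD[OF assms(3)] by (metis insert_iff)
  qed simp
  then show thesis using that by blast
qed

text \<open>A smallest nonempty subset closed under \<open>f\<close> is a union of cycles of \<open>f\<close>.\<close>

lemma finite_obtain_cyclic_part:
  assumes "finite D" "D \<noteq> {}" "f ` D \<subseteq> D"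
  obtains C \<sigma> where "C \<subseteq> D" "C \<noteq> {}" "bij \<sigma>" "\<And>x. x \<in> C \<Longrightarrow> \<sigma> x = f x"
    "\<And>x. x \<notin> C \<Longrightarrow> \<sigma> x = x" "\<sigma> ` C = C"
proof -
  define P where "P C \<longleftrightarrow> C \<subseteq> D \<and> C \<noteq> {} \<and> f ` C \<subseteq> C" for C
  have "P D" using assms by (simp add: P_def)
  then obtain C where PC: "P C" and least: "\<And>C'. P C' \<Longrightarrow> card C \<le> card C'"
    using ex_has_least_nat[of P D card] by blast
  have C: "C \<subseteq> D" "C \<noteq> {}" "f ` C \<subseteq> C" using PC by (simp_all add: P_def)
  have fin: "finite C" using C(1) assms(1) by (rule finite_subset)
  \<comment> \<open>The image of \<open>C\<close> is closed and nonempty as well, so minimality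
    forces it to be all of \<open>C\<close>; a surjection of a finite set onto itself is
    injective.\<close>
  have "P (f ` C)" using C image_mono[OF C(3), of f] by (simp add: P_def order_trans)
  then have "card C \<le> card (f ` C)" by (rule least)
  then have img: "f ` C = C"
    using card_subset_eq[OF fin C(3)] card_image_le[OF fin, of f] by linarith
  then have inj: "inj_on f C" using eq_card_imp_inj_on[OF fin, of f] by simp
  define \<sigma> where "\<sigma> x = (if x \<in> C then f x else x)" for x
  have "bij_betw \<sigma> C C" using inj img unfolding bij_betw_def inj_on_def \<sigma>_def by auto
  moreover have "bij_betw \<sigma> (- C) (- C)" unfolding bij_betw_def inj_on_def \<sigma>_def by auto
  ultimately have "bij_betw \<sigma> (C \<union> - C) (C \<union> - C)" by (rule bij_betw_combine) simp
  then have "bij \<sigma>" by simp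
  moreover have "\<sigma> ` C = C" using img by (simp add: \<sigma>_def)
  ultimately show thesis using that[of C \<sigma>] C by (simp add: \<sigma>_def)
qed

section \<open>Orders, assignments and blocking edges of an instance\<close>

locale assignment_problem =
  fixes I :: "('a, 'b) assignment_instance"
  assumes inst: "stable_assignment_instance I"
begin

lemma finite_edges: "finite (edges I)"
  using inst finite_subset[of "edges I" "students I \<times> schools I"]
  unfolding stable_assignment_instance_def by simp

lemma edge_vertices: "(a, b) \<in> edges I \<Longrightarrow> a \<in> students I \<and> b \<in> schools I"
  using inst unfolding stable_assignment_instance_def by blast

lemma student_order:
  assumes "(a, b) \<in> edges I"
  shows "trans (student_less I a)" "irrefl (student_less I a)"
    "(x, y) \<in> student_less I a \<Longrightarrow> (a, x) \<in> edges I \<and> (a, y) \<in> edges I"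
    "(a, x) \<in> edges I \<Longrightarrow> (a, y) \<in> edges I \<Longrightarrow>
      x = y \<or> (x, y) \<in> student_less I a \<or> (y, x) \<in> student_less I a"
proof -
  have "strict_total_order_of (schools_of (edges I) a) (student_less I a)"
    using inst edge_vertices[OF assms] unfolding stable_assignment_instance_def by blast
  then show "trans (student_less I a)" "irrefl (student_less I a)"
    "(x, y) \<in> student_less I a \<Longrightarrow> (a, x) \<in> edges I \<and> (a, y) \<in> edges I"
    "(a, x) \<in> edges I \<Longrightarrow> (a, y) \<in> edges I \<Longrightarrow>
      x = y \<or> (x, y) \<in> student_less I a \<or> (y, x) \<in> student_less I a"
    unfolding strict_total_order_of_def strict_linear_order_on_def schools_of_def total_on_def
    by blast+
qed

lemma school_order:
  assumes "(a, b) \<in> edges I"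
  shows "trans (school_less I b)" "irrefl (school_less I b)"
    "(x, y) \<in> school_less I b \<Longrightarrow> (x, b) \<in> edges I \<and> (y, b) \<in> edges I"
    "(x, b) \<in> edges I \<Longrightarrow> (y, b) \<in> edges I \<Longrightarrow>
      x = y \<or> (x, y) \<in> school_less I b \<or> (y, x) \<in> school_less I b"
proof -
  have "strict_total_order_of (students_of (edges I) b) (school_less I b)"
    using inst edge_vertices[OF assms] unfolding stable_assignment_instance_def by blast
  then show "trans (school_less I b)" "irrefl (school_less I b)"
    "(x, y) \<in> school_less I b \<Longrightarrow> (x, b) \<in> edges I \<and> (y, b) \<in> edges I"
    "(x, b) \<in> edges I \<Longrightarrow> (y, b) \<in> edges I \<Longrightarrow>
      x = y \<or> (x, y) \<in> school_less I b \<or> (y, x) \<in> school_less I b"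
    unfolding strict_total_order_of_def strict_linear_order_on_def students_of_def total_on_def
    by blast+
qed

lemma student_asym:
  "(a, b) \<in> edges I \<Longrightarrow> (x, y) \<in> student_less I a \<Longrightarrow> (y, x) \<notin> student_less I a \<and> x \<noteq> y"
  using student_order(1,2)[of a b] transD[of "student_less I a" x y x] transD[of "student_less I a" y x y]
  unfolding irrefl_def by blast

lemma school_asym:
  "(a, b) \<in> edges I \<Longrightarrow> (x, y) \<in> school_less I b \<Longrightarrow> (y, x) \<notin> school_less I b \<and> x \<noteq> y"
  using school_order(1,2)[of a b] transD[of "school_less I b" x y x] transD[of "school_less I b" y x y]
  unfolding irrefl_def by blast

lemma finite_students_of: "M \<subseteq> edges I \<Longrightarrow> finite (students_of M b)"
proof -
  assume "M \<subseteq> edges I"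
  then have "students_of M b \<subseteq> fst ` edges I" by (force simp: students_of_def)
  then show ?thesis using finite_edges finite_subset by blast
qed

lemma finite_schools_of: "M \<subseteq> edges I \<Longrightarrow> finite (schools_of M a)"
proof -
  assume "M \<subseteq> edges I"
  then have "schools_of M a \<subseteq> snd ` edges I" by (force simp: schools_of_def)
  then show ?thesis using finite_edges finite_subset by blast
qed

lemma assignments_edges: "M \<in> assignments I \<Longrightarrow> M \<subseteq> edges I"
  unfolding assignments_def by blast

lemma finite_assignments: "finite (assignments I)"
  by (rule finite_subset[of _ "Pow (edges I)"]) (use assignments_edges finite_edges in auto)

lemma assigned_unique:
  assumes "M \<in> assignments I" "(a, b) \<in> M" "(a, b') \<in> M"
  shows "b = b'"
proof -
  have "a \<in> students I" using assms assignments_edges edge_vertices by blast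
  then have "card (schools_of M a) \<le> Suc 0" using assms(1) unfolding assignments_def by simp
  moreover have "finite (schools_of M a)" using assms(1) assignments_edges finite_schools_of by blast
  ultimately show ?thesis
    using assms(2,3) card_le_Suc0_iff_eq[of "schools_of M a"] by (auto simp: schools_of_def)
qed

lemma card_students_of_le:
  "M \<in> assignments I \<Longrightarrow> (a, b) \<in> edges I \<Longrightarrow> card (students_of M b) \<le> quota I b"
  using edge_vertices unfolding assignments_def by blast

lemma assignmentsI:
  assumes "M \<subseteq> edges I" "\<And>a b b'. (a, b) \<in> M \<Longrightarrow> (a, b') \<in> M \<Longrightarrow> b = b'"
    "\<And>a b. (a, b) \<in> edges I \<Longrightarrow> card (students_of M b) \<le> quota I b"
  shows "M \<in> assignments I"
proof -
  have "card (schools_of M a) \<le> 1" for a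
    using assms(2) card_le_Suc0_iff_eq[OF finite_schools_of[OF assms(1)]]
    by (auto simp: schools_of_def)
  moreover have "card (students_of M b) \<le> quota I b" for b
  proof (cases "students_of M b = {}")
    case False
    then show ?thesis using assms(1,3) unfolding students_of_def by blast
  qed simp
  ultimately show ?thesis using assms(1) unfolding assignments_def by blast
qed

text \<open>An unmatched student satisfies the universal condition vacuously, which spares later
  proofs the case distinction.\<close>

lemma prefers_to_assigned_iff:
  assumes "M \<in> assignments I"
  shows "prefers_to_assigned I a b M \<longleftrightarrow> (\<forall>b'. (a, b') \<in> M \<longrightarrow> (b', b) \<in> student_less I a)"
proof (cases "\<exists>b'. (a, b') \<in> M")
  case True
  then obtain b' where b': "(a, b') \<in> M" by blast
  then have "schools_of M a = {b'}"
    using assigned_unique[OF assms] unfolding schools_of_def by blast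
  then have "prefers_to_assigned I a b M \<longleftrightarrow> (b', b) \<in> student_less I a"
    by (simp add: prefers_to_assigned_def)
  then show ?thesis using b' assigned_unique[OF assms b'] by blast
next
  case False
  then show ?thesis unfolding prefers_to_assigned_def schools_of_def by blast
qed

lemma edge_blocks_iff:
  "edge_blocks I (a, b) M \<longleftrightarrow> (a, b) \<in> edges I \<and> prefers_to_assigned I a b M \<and>
     (card (students_of M b) < quota I b \<or> (\<exists>a'. (a', b) \<in> M \<and> (a', a) \<in> school_less I b))"
  by (auto simp: edge_blocks_def students_of_def)

text \<open>The form in which stability is used: a school that refuses a willing student is full,
  and only with better students. The ranking is strict because \<open>a\<close>, strictly preferring
  \<open>b\<close> to her own seat, is not already at \<open>b\<close>.\<close>

lemma not_blocksD:
  assumes "M \<in> assignments I" "(a, b) \<in> edges I" "prefers_to_assigned I a b M"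
    "\<not> edge_blocks I (a, b) M"
  shows "card (students_of M b) = quota I b"
    "(a', b) \<in> M \<Longrightarrow> (a, a') \<in> school_less I b"
proof -
  show "card (students_of M b) = quota I b"
    using assms card_students_of_le[OF assms(1,2)] by (simp add: edge_blocks_iff)
  assume a': "(a', b) \<in> M"
  have "a' \<noteq> a"
    using a' assms(3) student_asym[OF assms(2)] unfolding prefers_to_assigned_iff[OF assms(1)] by blast
  moreover have "(a', a) \<notin> school_less I b" using assms a' by (simp add: edge_blocks_iff)
  moreover have "(a', b) \<in> edges I" using a' assms(1) assignments_edges by blast
  ultimately show "(a, a') \<in> school_less I b" using school_order(4)[OF assms(2)] assms(2) by blast
qed

lemma not_prefersD:
  assumes "M \<in> assignments I" "(a, b) \<in> edges I" "\<not> prefers_to_assigned I a b M"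
  obtains b' where "(a, b') \<in> M" "b' = b \<or> (b, b') \<in> student_less I a"
proof -
  obtain b' where "(a, b') \<in> M" "(b', b) \<notin> student_less I a"
    using assms prefers_to_assigned_iff by blast
  then show thesis using that student_order(4)[OF assms(2)] assms assignments_edges by blast
qed

section \<open>Assignments that no edge of a given set blocks\<close>

text \<open>Members may use edges outside \<open>E\<close>; only the blocking edges are restricted
  to \<open>E\<close>. For \<open>E = edges I\<close> these are the stable assignments.\<close>

definition unblocked :: "('a \<times> 'b) set \<Rightarrow> ('a \<times> 'b) set set" where
  "unblocked E = {M \<in> assignments I. \<forall>e\<in>E. \<not> edge_blocks I e M}"

definition unblocked_edges :: "('a \<times> 'b) set \<Rightarrow> ('a \<times> 'b) set" where
  "unblocked_edges E = \<Union> (unblocked E)"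

lemma unblocked_edges_antimono: "E \<subseteq> E' \<Longrightarrow> unblocked_edges E' \<subseteq> unblocked_edges E"
  unfolding unblocked_edges_def unblocked_def by blast

lemma unblocked_edges_subset: "unblocked_edges E \<subseteq> edges I"
  unfolding unblocked_edges_def unblocked_def using assignments_edges by blast

text \<open>
  Gale--Shapley: among the assignments in which only unmatched students block, one that is best
  for the schools is not blocked at all, since otherwise an unmatched student could be admitted
  to the best school with which she blocks.
\<close>

lemma unblocked_nonempty:
  assumes "E \<subseteq> edges I"
  shows "unblocked E \<noteq> {}"
proof -
  define S where "S = {M \<in> assignments I. \<forall>a b. (a, b) \<in> E \<longrightarrow> edge_blocks I (a, b) M \<longrightarrow> (\<forall>b'. (a, b') \<notin> M)}"
  \<comment> \<open>Counts the students that \<open>b\<close> ranks below \<open>a\<close>; the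
    \<open>Suc\<close> makes filling a free seat increase the total too.\<close>
  define rk where "rk = (\<lambda>(a, b). Suc (card {a'. (a', a) \<in> school_less I b}))"
  have "{} \<in> S" unfolding S_def assignments_def by (simp add: schools_of_def students_of_def)
  moreover have "finite S" unfolding S_def using finite_assignments by simp
  ultimately obtain M where M: "M \<in> S" and max: "\<And>M'. M' \<in> S \<Longrightarrow> sum rk M' \<le> sum rk M"
    using finite_obtain_maximizer[of S "sum rk"] by blast
  have MA: "M \<in> assignments I" and
    un: "\<And>a b b'. (a, b) \<in> E \<Longrightarrow> edge_blocks I (a, b) M \<Longrightarrow> (a, b') \<notin> M" using M unfolding S_def by auto
  have finM: "finite M" using MA assignments_edges finite_edges finite_subset by blast
  have False if eE: "e \<in> E" "edge_blocks I e M" for e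
  proof -
    obtain a b0 where e: "(a, b0) \<in> E" "edge_blocks I (a, b0) M" using eE by (metis surj_pair)
    define T where "T = {b. (a, b) \<in> E \<and> edge_blocks I (a, b) M}"
    have "T \<subseteq> schools_of (edges I) a" using assms unfolding T_def schools_of_def by blast
    then have "finite T" using finite_schools_of finite_subset by blast
    moreover have "T \<noteq> {}" using e T_def by blast
    moreover have "x = y \<or> (x, y) \<in> student_less I a \<or> (y, x) \<in> student_less I a"
      if "x \<in> T" "y \<in> T" for x y
      using that assms student_order(4) unfolding T_def by blast
    ultimately obtain b where "b \<in> T" and
      best: "\<And>x. x \<in> T \<Longrightarrow> x = b \<or> (x, b) \<in> student_less I a"
      using finite_obtain_greatest[of T "student_less I a"] student_order(1) e(1) assms by blast
    then have ab: "(a, b) \<in> E" "edge_blocks I (a, b) M" unfolding T_def by auto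
    then have abI: "(a, b) \<in> edges I" using assms by blast
    have a_un: "(a, b') \<notin> M" for b' using un ab by blast
    \<comment> \<open>\<open>K\<close> is what must be removed to admit \<open>a\<close>: nothing if
      a seat is free, otherwise the edge of one worse student. Both cases are then treated
      together.\<close>
    have "\<exists>K. K \<subseteq> M \<and> (K = {} \<and> card (students_of M b) < quota I b \<or>
      (\<exists>a'. K = {(a', b)} \<and> (a', a) \<in> school_less I b))"
      using ab(2) unfolding edge_blocks_iff by blast
    then obtain K where KM: "K \<subseteq> M" and K: "K = {} \<and> card (students_of M b) < quota I b \<or>
      (\<exists>a'. K = {(a', b)} \<and> (a', a) \<in> school_less I b)" by blast
    define M' where "M' = insert (a, b) (M - K)"
    have fM: "finite (students_of M b)" using MA assignments_edges finite_students_of by blast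
    have cardb: "card (students_of M' b) = (if K = {} then Suc (card (students_of M b)) else card (students_of M b))"
    proof (cases "K = {}")
      case True
      then have "students_of M' b = insert a (students_of M b)" "a \<notin> students_of M b"
        using a_un unfolding M'_def students_of_def by auto
      then show ?thesis using True fM by simp
    next
      case False
      then obtain a' where a': "K = {(a', b)}" using K by blast
      then have "students_of M' b = insert a (students_of M b - {a'})" "a \<notin> students_of M b"
        "a' \<in> students_of M b"
        using a_un KM unfolding M'_def students_of_def by auto
      then show ?thesis using False fM card_Suc_Diff1[of "students_of M b" a'] by simp
    qed
    have other: "students_of M' c = students_of M c" if "c \<noteq> b" for c
      using that K unfolding M'_def students_of_def by auto
    have M'A: "M' \<in> assignments I"
    proof (rule assignmentsI)
      show "M' \<subseteq> edges I" using abI MA assignments_edges unfolding M'_def by blast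
      show "y = y'" if "(x, y) \<in> M'" "(x, y') \<in> M'" for x y y'
        using that a_un assigned_unique[OF MA] unfolding M'_def by blast
      show "card (students_of M' y) \<le> quota I y" if "(x, y) \<in> edges I" for x y
        using K other[of y] cardb card_students_of_le[OF MA that] by (cases "y = b") auto
    qed
    \<comment> \<open>The change only improves schools, so a matched student other than
      \<open>a\<close> blocking \<open>M'\<close> would already block \<open>M\<close>. For
      \<open>a\<close> herself the choice of \<open>b\<close> as best in \<open>T\<close> excludes
      it. A displaced student may block, but she is unmatched.\<close>
    have "(x, y') \<notin> M'" if "(x, y) \<in> E" "edge_blocks I (x, y) M'" for x y y'
    proof
      assume xy': "(x, y') \<in> M'"
      have pref: "\<forall>b'. (x, b') \<in> M' \<longrightarrow> (b', y) \<in> student_less I x"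
        and xyI: "(x, y) \<in> edges I"
        using that(2) prefers_to_assigned_iff[OF M'A] by (auto simp: edge_blocks_iff)
      show False
      proof (cases "x = a")
        case True
        then have less: "(b, y) \<in> student_less I a" using pref unfolding M'_def by blast
        then have "y \<noteq> b" using student_asym[OF abI] by blast
        then have "edge_blocks I (a, y) M"
          using that(2) True other[of y] a_un K prefers_to_assigned_iff[OF MA, of a y]
          unfolding edge_blocks_iff M'_def by auto
        then have "y \<in> T" using that(1) True unfolding T_def by blast
        then show False using best less student_asym[OF abI less] by blast
      next
        case False
        then have xM: "(x, y') \<in> M" using xy' unfolding M'_def by blast
        then have "(x, y') \<in> M'" using xy' by simp
        then have "prefers_to_assigned I x y M"
          unfolding prefers_to_assigned_iff[OF MA] using pref xM assigned_unique[OF MA] by blast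
        moreover have "card (students_of M y) < quota I y" if "card (students_of M' y) < quota I y"
          using that other[of y] cardb by (cases "y = b") (auto split: if_splits)
        moreover have "card (students_of M y) < quota I y \<or> (\<exists>a'. (a', y) \<in> M \<and> (a', x) \<in> school_less I y)"
          if "(z, y) \<in> M'" "(z, x) \<in> school_less I y" for z
        proof (cases "(z, y) \<in> M")
          case True
          then show ?thesis using that by blast
        next
          case False
          then have "z = a" "y = b" using that unfolding M'_def by auto
          then show ?thesis using K KM that(2) transD[OF school_order(1)[OF abI]] by blast
        qed
        ultimately have "edge_blocks I (x, y) M"
          using that(2) xyI unfolding edge_blocks_iff by blast
        then show False using un that(1) xM by blast
      qed
    qed
    then have "M' \<in> S" using M'A unfolding S_def by blast
    moreover have "sum rk M < sum rk M'"
    proof -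
      have "sum rk M' = rk (a, b) + sum rk (M - K)"
        unfolding M'_def using finM a_un by simp
      moreover have "sum rk M = sum rk (M - K) + sum rk K" using KM finM by (simp add: sum.subset_diff)
      moreover have "sum rk K < rk (a, b)"
      proof (cases "K = {}")
        case True
        then show ?thesis by (simp add: rk_def)
      next
        case False
        then obtain a' where a': "K = {(a', b)}" "(a', a) \<in> school_less I b" using K by blast
        have "{x. (x, a) \<in> school_less I b} \<subseteq> students_of (edges I) b"
          using school_order(3)[OF abI] unfolding students_of_def by blast
        then have fin: "finite {x. (x, a) \<in> school_less I b}"
          using finite_students_of finite_subset by blast
        have "{x. (x, a') \<in> school_less I b} \<subset> {x. (x, a) \<in> school_less I b}"
          using a'(2) transD[OF school_order(1)[OF abI]] school_asym[OF abI] by blast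
        then show ?thesis using psubset_card_mono[OF fin] a'(1) by (simp add: rk_def)
      qed
      ultimately show ?thesis by simp
    qed
    ultimately show False using max by (meson not_less)
  qed
  then show ?thesis using MA unfolding unblocked_def by blast
qed

section \<open>Exchange between assignments that do not block each other\<close>

text \<open>
  Neither of \<open>M\<close> and \<open>N\<close> blocks the other. The students who prefer \<open>M\<close> are counted by the
  schools they attend under \<open>M\<close> and under \<open>N\<close>: no school has more of them under \<open>M\<close> than under
  \<open>N\<close>, hence every school has equally many.
\<close>

lemma mutually_unblocked:
  assumes M: "M \<in> assignments I" and N: "N \<in> assignments I"
    and MN: "\<forall>e\<in>M. \<not> edge_blocks I e N" and NM: "\<forall>e\<in>N. \<not> edge_blocks I e M"
    and ab: "(a, b) \<in> M" "prefers_to_assigned I a b N"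
  shows "\<exists>c a'. (a, c) \<in> N \<and> (a', c) \<in> M \<and> prefers_to_assigned I a' c N"
    and "card (students_of M b) = quota I b"
proof -
  have ME: "M \<subseteq> edges I" and NE: "N \<subseteq> edges I" using M N assignments_edges by auto
  define P where "P = {(a, b). (a, b) \<in> M \<and> prefers_to_assigned I a b N}"
  define Q where "Q = {(a, b). (a, b) \<in> N \<and> a \<in> fst ` P}"
  have PM: "P \<subseteq> M" and QN: "Q \<subseteq> N" unfolding P_def Q_def by auto
  have fin: "finite P" "finite Q" using PM QN ME NE finite_edges by (meson finite_subset)+
  \<comment> \<open>\<open>x\<close> wants \<open>y\<close> but does not block \<open>N\<close>, so
    \<open>N\<close> fills \<open>y\<close> with students ranked above \<open>x\<close>. One of them
    who is not at \<open>y\<close> in \<open>M\<close> cannot prefer \<open>y\<close> to her seat in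
    \<open>M\<close>, or she would block \<open>M\<close> by displacing \<open>x\<close>; so she
    prefers \<open>M\<close> and is counted in \<open>Q\<close>. The quota bound on \<open>M\<close>
    then gives the comparison with \<open>P\<close>.\<close>
  have count: "card (students_of P y) \<le> card (students_of Q y) \<and>
      card (students_of N y) = quota I y \<and>
      card (students_of N y) + card (students_of P y) \<le> card (students_of Q y) + card (students_of M y)"
    if xy: "(x, y) \<in> P" for x y
  proof -
    have xM: "(x, y) \<in> M" "prefers_to_assigned I x y N" using xy unfolding P_def by auto
    have xyI: "(x, y) \<in> edges I" using xM ME by blast
    note full = not_blocksD[OF N xyI xM(2) MN[rule_format, OF xM(1)]]
    have "z \<in> students_of Q y \<union> (students_of N y \<inter> students_of M y)" if z: "(z, y) \<in> N" for z
    proof (cases "(z, y) \<in> M")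
      case True
      then show ?thesis using z by (simp add: students_of_def)
    next
      case False
      have zyI: "(z, y) \<in> edges I" using z NE by blast
      have "\<not> prefers_to_assigned I z y M"
        using not_blocksD(2)[OF M zyI _ NM[rule_format, OF z] xM(1)] full(2)[OF z] school_asym[OF xyI] by blast
      then obtain w where w: "(z, w) \<in> M" "w = y \<or> (y, w) \<in> student_less I z"
        using not_prefersD[OF M zyI] by blast
      then have "(y, w) \<in> student_less I z" using False by blast
      then have "prefers_to_assigned I z w N"
        unfolding prefers_to_assigned_iff[OF N] using assigned_unique[OF N z] by blast
      then have "(z, w) \<in> P" using w(1) unfolding P_def by blast
      then show ?thesis using z unfolding Q_def students_of_def by force
    qed
    then have sub: "students_of N y \<subseteq> students_of Q y \<union> (students_of N y \<inter> students_of M y)"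
      by (auto simp: students_of_def)
    have fs: "finite (students_of M y)" "finite (students_of N y)"
        "finite (students_of P y)" "finite (students_of Q y)"
      using finite_students_of ME NE PM QN by (meson order_trans)+
    have "card (students_of N y) \<le> card (students_of Q y \<union> (students_of N y \<inter> students_of M y))"
      by (rule card_mono[OF _ sub]) (use fs in simp)
    also have "\<dots> \<le> card (students_of Q y) + card (students_of N y \<inter> students_of M y)"
      by (rule card_Un_le)
    finally have 1: "card (students_of N y) \<le> card (students_of Q y) + card (students_of N y \<inter> students_of M y)" .
    have "(p, y) \<notin> N" if "(p, y) \<in> P" for p
      using that prefers_to_assigned_iff[OF N] student_asym[of p y] ME unfolding P_def by blast
    then have "students_of P y \<inter> (students_of N y \<inter> students_of M y) = {}"
      by (auto simp: students_of_def)
    then have "card (students_of P y) + card (students_of N y \<inter> students_of M y)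
        = card (students_of P y \<union> (students_of N y \<inter> students_of M y))"
      using fs by (simp add: card_Un_disjoint)
    also have "\<dots> \<le> card (students_of M y)"
      using fs PM by (intro card_mono) (auto simp: students_of_def)
    finally show ?thesis using 1 full(1) card_students_of_le[OF M xyI] by linarith
  qed
  then have le: "card (students_of P y) \<le> card (students_of Q y)" for y
    by (cases "students_of P y = {}") (auto simp: students_of_def)
  have sums: "card R = (\<Sum>y\<in>schools I. card (students_of R y))" if R: "R \<subseteq> edges I" for R
  proof -
    have "R = (\<lambda>(y, x). (x, y)) ` (SIGMA y:schools I. students_of R y)"
      using R edge_vertices by (force simp: students_of_def)
    moreover have "inj_on (\<lambda>(y, x). (x, y)) (SIGMA y:schools I. students_of R y)"
      by (auto simp: inj_on_def)
    ultimately have "card R = card (SIGMA y:schools I. students_of R y)" by (metis card_image)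
    also have "\<dots> = (\<Sum>y\<in>schools I. card (students_of R y))"
      using inst R finite_students_of unfolding stable_assignment_instance_def by (intro card_SigmaI) auto
    finally show ?thesis .
  qed
  have injP: "inj_on fst P" and injQ: "inj_on fst Q"
    using assigned_unique[OF M] assigned_unique[OF N] PM QN unfolding inj_on_def by fastforce+
  \<comment> \<open>Each student of \<open>P\<close> has at most one edge in \<open>N\<close>, so
    \<open>Q\<close> is no larger than \<open>P\<close>. With the inequality at each school this
    forces equality at every school, and every student of \<open>P\<close> is matched in
    \<open>N\<close>.\<close>
  have QP: "fst ` Q \<subseteq> fst ` P" unfolding Q_def by auto (metis fst_conv image_eqI)
  then have cQP: "card Q \<le> card P"
    using card_image[OF injP] card_image[OF injQ] card_mono[OF finite_imageI[OF fin(1)] QP] by simp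
  have sP: "card P = (\<Sum>y\<in>schools I. card (students_of P y))"
    and sQ: "card Q = (\<Sum>y\<in>schools I. card (students_of Q y))"
    using sums PM QN ME NE by blast+
  have finB: "finite (schools I)" using inst unfolding stable_assignment_instance_def by blast
  have cPQ: "card P = card Q" unfolding sP sQ
    using cQP[unfolded sP sQ] sum_mono[of "schools I", OF le] by (meson le_antisym)
  have eq: "card (students_of P y) = card (students_of Q y)" if "y \<in> schools I" for y
  proof (rule ccontr)
    assume "\<not> ?thesis"
    then have "card (students_of P y) < card (students_of Q y)" using le[of y] by simp
    then have "card P < card Q" unfolding sP sQ
      using that le finB by (intro sum_strict_mono_ex1) auto
    then show False using cPQ by simp
  qed
  have "fst ` Q = fst ` P"
    using QP cPQ card_image[OF injP] card_image[OF injQ] fin by (intro card_subset_eq) auto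
  moreover have abP: "(a, b) \<in> P" using ab unfolding P_def by blast
  ultimately have "a \<in> fst ` Q" by force
  then obtain c where c: "(a, c) \<in> Q" by force
  then have cN: "(a, c) \<in> N" using QN by blast
  then have cB: "c \<in> schools I" using NE edge_vertices by blast
  have "a \<in> students_of Q c" "finite (students_of Q c)"
    using c QN NE finite_students_of by (auto simp: students_of_def)
  then have "card (students_of P c) \<noteq> 0" using eq[OF cB] by auto
  then obtain a' where "a' \<in> students_of P c" by fastforce
  then show "\<exists>c a'. (a, c) \<in> N \<and> (a', c) \<in> M \<and> prefers_to_assigned I a' c N"
    using cN unfolding P_def students_of_def by blast
  \<comment> \<open>Once \<open>P\<close> and \<open>Q\<close> agree in size at \<open>b\<close>,
    the last inequality of \<open>count\<close> says that \<open>M\<close> has at least as many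
    students at \<open>b\<close> as \<open>N\<close>, which fills it.\<close>
  have abI: "(a, b) \<in> edges I" using ab ME by blast
  then show "card (students_of M b) = quota I b"
    using count[OF abP] eq[of b] edge_vertices[OF abI] card_students_of_le[OF M abI] by simp
qed

section \<open>Rotations of stable assignments\<close>

text \<open>Student \<open>a\<close> takes the seat of \<open>\<sigma> a\<close>, so the students of
  each school are replaced by their preimage under a bijection and quotas stay respected.\<close>

lemma rotation_assignment:
  assumes N: "N \<in> assignments I" and \<sigma>: "bij \<sigma>"
    and sub: "{(a, b). (\<sigma> a, b) \<in> N} \<subseteq> edges I"
  shows "{(a, b). (\<sigma> a, b) \<in> N} \<in> assignments I"
    and "card (students_of {(a, b). (\<sigma> a, b) \<in> N} b) = card (students_of N b)"
proof -
  show card: "card (students_of {(a, b). (\<sigma> a, b) \<in> N} b) = card (students_of N b)" for b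
  proof -
    have "students_of N b = \<sigma> ` students_of {(a, b). (\<sigma> a, b) \<in> N} b"
      using bij_is_surj[OF \<sigma>] unfolding students_of_def by (fastforce simp: image_iff dest: surjD)
    then show ?thesis by (metis card_image bij_is_inj[OF \<sigma>] inj_on_subset subset_UNIV)
  qed
  show "{(a, b). (\<sigma> a, b) \<in> N} \<in> assignments I"
    using sub by (rule assignmentsI) (use assigned_unique[OF N] card card_students_of_le[OF N] in auto)
qed

text \<open>Any edge of \<open>Y\<close> lies in an assignment \<open>M\<close> unblocked by
  \<open>X\<close>. As \<open>M\<close> is contained in \<open>Y\<close> and \<open>N\<close> in
  \<open>X\<close>, the two cannot block each other, so \<open>mutually_unblocked\<close> applies in
  both directions.\<close>

lemma obtain_mutually_unblocked:
  assumes XY: "X = unblocked_edges Y" "Y = unblocked_edges X" "X \<subseteq> Y"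
    and N: "N \<in> unblocked Y" and xy: "(x, y) \<in> Y"
  obtains M where "M \<in> assignments I" "M \<subseteq> Y" "(x, y) \<in> M"
    "\<forall>e\<in>M. \<not> edge_blocks I e N" "\<forall>e\<in>N. \<not> edge_blocks I e M"
proof -
  obtain M where M: "M \<in> unblocked X" "(x, y) \<in> M" using xy XY(2) unfolding unblocked_edges_def by blast
  have "M \<subseteq> Y" using M(1) XY(2) unfolding unblocked_edges_def by blast
  moreover have "N \<subseteq> X" using N XY(1) unfolding unblocked_edges_def by blast
  ultimately show thesis using that M N unfolding unblocked_def by blast
qed

text \<open>
  Every school gives a seat to the best student who would prefer to move there along an edge
  of \<open>Y\<close>.
\<close>

lemma upward_rotation:
  assumes XY: "X = unblocked_edges Y" "Y = unblocked_edges X" "X \<subseteq> Y"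
    and N: "N \<in> unblocked Y" and xy: "(x0, y0) \<in> Y" "prefers_to_assigned I x0 y0 N"
  obtains N' where "N' \<in> unblocked Y"
    "{(a, b) \<in> Y. prefers_to_assigned I a b N'} \<subset> {(a, b) \<in> Y. prefers_to_assigned I a b N}"
proof -
  define U where "U = {(a, b) \<in> Y. prefers_to_assigned I a b N}"
  have NA: "N \<in> assignments I" and NY: "\<And>e. e \<in> Y \<Longrightarrow> \<not> edge_blocks I e N"
    using N unfolding unblocked_def by auto
  have YI: "Y \<subseteq> edges I" using XY(2) unblocked_edges_subset by blast
  have NsubY: "N \<subseteq> Y" using N XY unfolding unblocked_edges_def by blast
  define G where "G b c \<longleftrightarrow> (c, b) \<in> U \<and> (\<forall>c'. (c', b) \<in> U \<longrightarrow> c' = c \<or> (c', c) \<in> school_less I b)" for b c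
  have G_ex: "\<exists>c. G b c" if "(c, b) \<in> U" for b c
  proof -
    have UI: "U \<subseteq> edges I" using YI unfolding U_def by blast
    then have "finite (students_of U b)" by (rule finite_students_of)
    moreover have "students_of U b \<noteq> {}" using that by (auto simp: students_of_def)
    moreover have "trans (school_less I b)" using school_order(1) UI that by blast
    moreover have "u = v \<or> (u, v) \<in> school_less I b \<or> (v, u) \<in> school_less I b"
      if "u \<in> students_of U b" "v \<in> students_of U b" for u v
      using that UI school_order(4) unfolding students_of_def by blast
    ultimately obtain m where "m \<in> students_of U b"
      "\<And>x. x \<in> students_of U b \<Longrightarrow> x = m \<or> (x, m) \<in> school_less I b"
      using finite_obtain_greatest by blast
    then show ?thesis unfolding G_def students_of_def by blast
  qed
  define D where "D = fst ` U"
  \<comment> \<open>Comparing \<open>N\<close> with an assignment through the desired edge shows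
    that \<open>a\<close> holds a seat at a school that some student wants along \<open>Y\<close>,
    so this school has a best such candidate.\<close>
  have "\<exists>c. \<exists>b. (a, b) \<in> N \<and> G b c" if "a \<in> D" for a
  proof -
    obtain b where ab: "(a, b) \<in> U" using \<open>a \<in> D\<close> unfolding D_def by force
    then have "(a, b) \<in> Y" and pref: "prefers_to_assigned I a b N" unfolding U_def by auto
    then obtain M where M: "M \<in> assignments I" "M \<subseteq> Y" "(a, b) \<in> M"
      "\<forall>e\<in>M. \<not> edge_blocks I e N" "\<forall>e\<in>N. \<not> edge_blocks I e M"
      using obtain_mutually_unblocked[OF XY N] by blast
    obtain c a' where "(a, c) \<in> N" "(a', c) \<in> M" "prefers_to_assigned I a' c N"
      using mutually_unblocked(1)[OF M(1) NA M(4) M(5) M(3) pref] by blast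
    then show ?thesis using G_ex[of a' c] M(2) unfolding U_def by blast
  qed
  then obtain f where f: "\<And>a. a \<in> D \<Longrightarrow> \<exists>b. (a, b) \<in> N \<and> G b (f a)" by metis
  have "finite D" unfolding D_def U_def
    by (rule finite_imageI, rule finite_subset[OF _ finite_edges]) (use YI in auto)
  moreover have "D \<noteq> {}" using xy unfolding D_def U_def by blast
  moreover have "f ` D \<subseteq> D" using f unfolding G_def D_def by force
  ultimately obtain C \<tau> where C: "C \<subseteq> D" "C \<noteq> {}" "bij \<tau>" "\<And>x. x \<in> C \<Longrightarrow> \<tau> x = f x"
    "\<And>x. x \<notin> C \<Longrightarrow> \<tau> x = x" "\<tau> ` C = C"
    using finite_obtain_cyclic_part[of D f] by metis
  \<comment> \<open>\<open>f a\<close> is the student who receives the seat of \<open>a\<close>,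
    whereas \<open>rotation_assignment\<close> needs the student whose seat is taken; hence the
    inverse.\<close>
  define \<sigma> where "\<sigma> = inv \<tau>"
  have \<sigma>: "bij \<sigma>" "\<And>x. \<sigma> (\<tau> x) = x" "\<And>x. \<tau> (\<sigma> x) = x"
    using C(3) unfolding \<sigma>_def by (simp_all add: bij_imp_bij_inv bij_is_inj bij_is_surj surj_f_inv_f)
  define N' where "N' = {(a, b). (\<sigma> a, b) \<in> N}"
  have moved: "G b a \<or> (a, b) \<in> N \<and> \<sigma> a = a" if "(a, b) \<in> N'" for a b
  proof (cases "\<sigma> a \<in> C")
    case True
    then have "a = f (\<sigma> a)" using C(4) \<sigma>(3) by metis
    moreover obtain b' where "(\<sigma> a, b') \<in> N" "G b' (f (\<sigma> a))" using f True C(1) by blast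
    ultimately show ?thesis using that assigned_unique[OF NA] unfolding N'_def by auto
  next
    case False
    then have "\<sigma> a = a" using C(5) \<sigma>(3) by metis
    then show ?thesis using that unfolding N'_def by simp
  qed
  have N'Y: "N' \<subseteq> Y" using moved NsubY unfolding G_def U_def by fastforce
  note N'A = rotation_assignment[OF NA \<sigma>(1), folded N'_def, OF order_trans[OF N'Y YI]]
  have up: "prefers_to_assigned I a b N" if pref: "prefers_to_assigned I a b N'" and "(a, b) \<in> Y" for a b
    unfolding prefers_to_assigned_iff[OF NA]
  proof (intro allI impI)
    fix b' assume b': "(a, b') \<in> N"
    have abI: "(a, b) \<in> edges I" using that YI by blast
    show "(b', b) \<in> student_less I a"
    proof (cases "\<sigma> a \<in> C")
      case True
      then obtain c where c: "(\<sigma> a, c) \<in> N" using f C(1) by blast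
      then have aN': "(a, c) \<in> N'" unfolding N'_def by simp
      then have "(c, b) \<in> student_less I a" using pref unfolding prefers_to_assigned_iff[OF N'A(1)] by blast
      moreover have "c = b' \<or> (b', c) \<in> student_less I a"
        using moved[OF aN'] b' assigned_unique[OF NA] unfolding G_def U_def
        by (auto simp: prefers_to_assigned_iff[OF NA])
      ultimately show ?thesis using transD[OF student_order(1)[OF abI]] by blast
    next
      case False
      then have "\<sigma> a = a" using C(5) \<sigma>(3) by metis
      then have "(a, b') \<in> N'" using b' unfolding N'_def by simp
      then show ?thesis using pref unfolding prefers_to_assigned_iff[OF N'A(1)] by blast
    qed
  qed
  \<comment> \<open>By \<open>up\<close>, \<open>a\<close> already wanted \<open>b\<close> under
    \<open>N\<close>, so \<open>b\<close> was full, and it remains full. Students kept there were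
    ranked above \<open>a\<close>, and a newcomer is the best of all who wanted
    \<open>b\<close>.\<close>
  have "\<not> edge_blocks I (a, b) N'" if ab: "(a, b) \<in> Y" for a b
  proof
    assume bl: "edge_blocks I (a, b) N'"
    then have pref: "prefers_to_assigned I a b N" using up ab by (simp add: edge_blocks_iff)
    have abI: "(a, b) \<in> edges I" using ab YI by blast
    note full = not_blocksD[OF NA abI pref NY[OF ab]]
    obtain x where x: "(x, b) \<in> N'" "(x, a) \<in> school_less I b"
      using bl full(1) N'A(2) by (auto simp: edge_blocks_iff)
    have "a = x \<or> (a, x) \<in> school_less I b"
      using moved[OF x(1)] full(2) ab pref unfolding G_def U_def by blast
    then show False using school_asym[OF abI x(2)] by blast
  qed
  then have "N' \<in> unblocked Y" using N'A(1) unfolding unblocked_def by auto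
  moreover have "{(a, b) \<in> Y. prefers_to_assigned I a b N'} \<subset> U"
  proof -
    obtain c where c: "c \<in> C" using C(2) by blast
    then obtain b where b: "(c, b) \<in> N" "G b (f c)" using f C(1) by blast
    have "(f c, b) \<in> N'" using b(1) \<sigma>(2) C(4)[OF c] unfolding N'_def by (metis (mono_tags, lifting) CollectI case_prodI)
    moreover have fcU: "(f c, b) \<in> U" using b(2) unfolding G_def by blast
    moreover have "(f c, b) \<in> edges I" using fcU YI unfolding U_def by blast
    ultimately have "\<not> prefers_to_assigned I (f c) b N'"
      unfolding prefers_to_assigned_iff[OF N'A(1)] using student_asym by blast
    then show ?thesis using fcU up unfolding U_def by blast
  qed
  ultimately show thesis using that unfolding U_def by blast
qed

text \<open>
  Students step down to their next school along \<open>Y\<close>, where each takes the seat of the worst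
  student.
\<close>

lemma downward_rotation:
  assumes XY: "X = unblocked_edges Y" "Y = unblocked_edges X" "X \<subseteq> Y"
    and N: "N \<in> unblocked Y" and xy: "(x0, y0) \<in> Y" "(x0, y0) \<notin> N" "\<not> prefers_to_assigned I x0 y0 N"
  obtains N' where "N' \<in> unblocked Y"
    "{(a, b) \<in> Y. prefers_to_assigned I a b N} \<subset> {(a, b) \<in> Y. prefers_to_assigned I a b N'}"
    "{(a, b) \<in> Y. prefers_to_assigned I a b N'} \<subseteq> {(a, b) \<in> Y. prefers_to_assigned I a b N} \<union> N"
proof -
  have NA: "N \<in> assignments I" and NY: "\<And>e. e \<in> Y \<Longrightarrow> \<not> edge_blocks I e N"
    using N unfolding unblocked_def by auto
  have YI: "Y \<subseteq> edges I" using XY(2) unblocked_edges_subset by blast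
  have NI: "N \<subseteq> edges I" using NA assignments_edges by blast
  have NsubY: "N \<subseteq> Y" using N XY unfolding unblocked_edges_def by blast
  define L where "L = {(a, b) \<in> Y. \<exists>c. (a, c) \<in> N \<and> (b, c) \<in> student_less I a}"
  define D where "D = fst ` L"
  have LI: "L \<subseteq> edges I" using YI unfolding L_def by blast
  define W where "W b w \<longleftrightarrow> (w, b) \<in> N \<and> (\<forall>z. (z, b) \<in> N \<longrightarrow> z = w \<or> (w, z) \<in> school_less I b)" for b w
  define H where "H a b \<longleftrightarrow> (a, b) \<in> L \<and> (\<forall>b'. (a, b') \<in> L \<longrightarrow> b' = b \<or> (b', b) \<in> student_less I a)" for a b
  \<comment> \<open>Let \<open>M\<close> contain \<open>(a, b)\<close>. Since \<open>a\<close>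
    prefers \<open>N\<close> to \<open>M\<close>, the exchange lemma with roles swapped yields
    \<open>y\<close> at \<open>b\<close> in \<open>N\<close> who prefers \<open>b\<close> to her
    seat in \<open>M\<close>, and shows that \<open>N\<close> fills \<open>b\<close>. As
    \<open>y\<close> does not block \<open>M\<close>, all of \<open>M\<close> at \<open>b\<close>,
    in particular \<open>a\<close>, is ranked above \<open>y\<close> and so above the worst student
    \<open>w\<close>.\<close>
  have step: "\<exists>w. W b w \<and> w \<in> D \<and> (w, a) \<in> school_less I b \<and> card (students_of N b) = quota I b"
    if ab: "(a, b) \<in> L" for a b
  proof -
    obtain c where c: "(a, c) \<in> N" "(b, c) \<in> student_less I a" and abY: "(a, b) \<in> Y"
      using ab unfolding L_def by blast
    obtain M where M: "M \<in> assignments I" "M \<subseteq> Y" "(a, b) \<in> M"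
      "\<forall>e\<in>M. \<not> edge_blocks I e N" "\<forall>e\<in>N. \<not> edge_blocks I e M"
      using obtain_mutually_unblocked[OF XY N abY] by blast
    note up = mutually_unblocked[OF M(1) NA M(4) M(5)]
    note down = mutually_unblocked[OF NA M(1) M(5) M(4)]
    have "prefers_to_assigned I a c M"
      unfolding prefers_to_assigned_iff[OF M(1)] using c(2) assigned_unique[OF M(1) M(3)] by blast
    then obtain y where y: "(y, b) \<in> N" "prefers_to_assigned I y b M"
      using down(1)[OF c(1)] assigned_unique[OF M(1) M(3)] by blast
    have yI: "(y, b) \<in> edges I" using y NI by blast
    note full = not_blocksD(2)[OF M(1) yI y(2) M(5)[rule_format, OF y(1)]]
    have "finite (students_of N b)" using NI by (rule finite_students_of)
    moreover have "students_of N b \<noteq> {}" using y by (auto simp: students_of_def)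
    moreover have "trans ((school_less I b)\<inverse>)" using school_order(1)[OF yI] by simp
    moreover have "u = v \<or> (u, v) \<in> (school_less I b)\<inverse> \<or> (v, u) \<in> (school_less I b)\<inverse>"
      if "u \<in> students_of N b" "v \<in> students_of N b" for u v
      using that NI school_order(4)[OF yI] unfolding students_of_def by blast
    ultimately obtain w where "w \<in> students_of N b"
      "\<And>z. z \<in> students_of N b \<Longrightarrow> z = w \<or> (z, w) \<in> (school_less I b)\<inverse>"
      using finite_obtain_greatest by blast
    then have w: "(w, b) \<in> N" "\<And>z. (z, b) \<in> N \<Longrightarrow> z = w \<or> (w, z) \<in> school_less I b"
      unfolding students_of_def by auto
    have wI: "(w, b) \<in> edges I" using w NI by blast
    have wy: "y = w \<or> (w, y) \<in> school_less I b" using w(2) y(1) by blast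
    have "(w, a) \<in> school_less I b"
      using wy full[OF M(3)] transD[OF school_order(1)[OF yI]] by blast
    moreover have "w \<in> D"
    proof (cases "prefers_to_assigned I w b M")
      case True
      obtain d where d: "(w, d) \<in> M" using down(1)[OF w(1) True] by blast
      then have "(d, b) \<in> student_less I w" using True prefers_to_assigned_iff[OF M(1)] by blast
      then have "(w, d) \<in> L" using d M(2) w(1) unfolding L_def by blast
      then show ?thesis unfolding D_def by force
    next
      \<comment> \<open>Here \<open>w\<close> would prefer her seat in \<open>M\<close>. The
        exchange lemma then gives \<open>m\<close> at \<open>b\<close> in \<open>M\<close> who wants
        \<open>b\<close> under \<open>N\<close> but does not block, so \<open>b\<close> ranks
        \<open>m\<close> below \<open>y\<close>, contradicting \<open>full\<close>.\<close>
      case False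
      then obtain d where d: "(w, d) \<in> M" "d = b \<or> (b, d) \<in> student_less I w"
        using not_prefersD[OF M(1) wI] by blast
      have "(w, b) \<notin> M" using full wy school_asym[OF yI] by blast
      then have "(b, d) \<in> student_less I w" using d by blast
      then have "prefers_to_assigned I w d N"
        unfolding prefers_to_assigned_iff[OF NA] using assigned_unique[OF NA w(1)] by blast
      then obtain m where m: "(m, b) \<in> M" "prefers_to_assigned I m b N"
        using up(1)[OF d(1)] assigned_unique[OF NA w(1)] by blast
      then have "(m, b) \<in> edges I" using M(2) YI by blast
      then have "(m, y) \<in> school_less I b" using not_blocksD(2)[OF NA _ m(2) M(4)[rule_format, OF m(1)] y(1)] by blast
      then show ?thesis using full[OF m(1)] school_asym[OF yI] by blast
    qed
    moreover have "card (students_of N b) = quota I b" using down(2)[OF y] .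
    ultimately show ?thesis using w unfolding W_def by blast
  qed
  have "\<exists>p. H a (fst p) \<and> W (fst p) (snd p) \<and> snd p \<in> D \<and> (snd p, a) \<in> school_less I (fst p)
      \<and> card (students_of N (fst p)) = quota I (fst p)" if "a \<in> D" for a
  proof -
    have "finite (schools_of L a)" using LI by (rule finite_schools_of)
    moreover have "schools_of L a \<noteq> {}" using that unfolding D_def schools_of_def by force
    moreover have "trans (student_less I a)" using student_order(1) LI that unfolding D_def by force
    moreover have "u = v \<or> (u, v) \<in> student_less I a \<or> (v, u) \<in> student_less I a"
      if "u \<in> schools_of L a" "v \<in> schools_of L a" for u v
      using that LI student_order(4) unfolding schools_of_def by blast
    ultimately obtain b where "b \<in> schools_of L a"
      "\<And>x. x \<in> schools_of L a \<Longrightarrow> x = b \<or> (x, b) \<in> student_less I a"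
      using finite_obtain_greatest by blast
    then have "H a b" unfolding H_def schools_of_def by blast
    moreover then obtain w where "W b w \<and> w \<in> D \<and> (w, a) \<in> school_less I b \<and> card (students_of N b) = quota I b"
      using step unfolding H_def by blast
    ultimately have "H a (fst (b, w)) \<and> W (fst (b, w)) (snd (b, w)) \<and> snd (b, w) \<in> D
      \<and> (snd (b, w), a) \<in> school_less I (fst (b, w))
      \<and> card (students_of N (fst (b, w))) = quota I (fst (b, w))" by simp
    then show ?thesis by blast
  qed
  then obtain p where p: "\<And>a. a \<in> D \<Longrightarrow> H a (fst (p a)) \<and> W (fst (p a)) (snd (p a)) \<and> snd (p a) \<in> D
      \<and> (snd (p a), a) \<in> school_less I (fst (p a)) \<and> card (students_of N (fst (p a))) = quota I (fst (p a))"
    by metis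
  define t where "t a = fst (p a)" for a
  define f where "f a = snd (p a)" for a
  have tf: "H a (t a)" "W (t a) (f a)" "f a \<in> D" "(f a, a) \<in> school_less I (t a)"
    "card (students_of N (t a)) = quota I (t a)" if "a \<in> D" for a
    using p[OF that] unfolding t_def f_def by auto
  have "finite D" unfolding D_def using LI finite_edges by (meson finite_imageI finite_subset)
  moreover have "D \<noteq> {}"
  proof -
    have "(x0, y0) \<in> edges I" using xy(1) YI by blast
    then obtain c where "(x0, c) \<in> N" "c = y0 \<or> (y0, c) \<in> student_less I x0"
      using not_prefersD[OF NA _ xy(3)] by blast
    then have "(x0, y0) \<in> L" using xy unfolding L_def by blast
    then show ?thesis unfolding D_def by blast
  qed
  moreover have "f ` D \<subseteq> D" using tf(3) by blast
  ultimately obtain C \<sigma> where C: "C \<subseteq> D" "C \<noteq> {}" "bij \<sigma>" "\<And>x. x \<in> C \<Longrightarrow> \<sigma> x = f x"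
    "\<And>x. x \<notin> C \<Longrightarrow> \<sigma> x = x" "\<sigma> ` C = C"
    using finite_obtain_cyclic_part[of D f] by metis
  define N' where "N' = {(a, b). (\<sigma> a, b) \<in> N}"
  have outC: "(a, b) \<in> N' \<longleftrightarrow> (a, b) \<in> N" if "a \<notin> C" for a b
    using C(5)[OF that] unfolding N'_def by simp
  have inC: "(a, b) \<in> N' \<longleftrightarrow> b = t a" if "a \<in> C" for a b
  proof -
    have "(f a, t a) \<in> N" using tf(2) that C(1) unfolding W_def by blast
    then show ?thesis using C(4)[OF that] assigned_unique[OF NA] unfolding N'_def by auto
  qed
  have LC: "(a, t a) \<in> L" if "a \<in> C" for a using tf(1) that C(1) unfolding H_def by blast
  have N'Y: "N' \<subseteq> Y"
  proof
    fix e assume "e \<in> N'"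
    then show "e \<in> Y" using outC inC LC NsubY unfolding L_def by (cases e; cases "fst e \<in> C") auto
  qed
  note N'A = rotation_assignment[OF NA C(3), folded N'_def, OF order_trans[OF N'Y YI]]
  have down: "prefers_to_assigned I a b N'" if pref: "prefers_to_assigned I a b N" and "(a, b) \<in> Y" for a b
  proof (cases "a \<in> C")
    case True
    obtain c where c: "(a, c) \<in> N" "(t a, c) \<in> student_less I a" using LC[OF True] unfolding L_def by blast
    then have "(c, b) \<in> student_less I a" using pref prefers_to_assigned_iff[OF NA] by blast
    then have "(t a, b) \<in> student_less I a"
      using c student_order(1) that(2) YI by (meson subsetD transD)
    then show ?thesis unfolding prefers_to_assigned_iff[OF N'A(1)] using inC[OF True] by simp
  next
    case False
    then show ?thesis using pref unfolding prefers_to_assigned_iff[OF N'A(1)] prefers_to_assigned_iff[OF NA]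
      using outC by blast
  qed
  \<comment> \<open>As \<open>t a\<close> is the best school below the seat held in
    \<open>N\<close>, no edge of \<open>Y\<close> lies strictly between; only the abandoned edge
    becomes newly desirable.\<close>
  have new: "a \<in> C \<and> (a, b) \<in> N"
    if pref': "prefers_to_assigned I a b N'" and ab: "(a, b) \<in> Y" and npref: "\<not> prefers_to_assigned I a b N" for a b
  proof -
    have abI: "(a, b) \<in> edges I" using ab YI by blast
    have aC: "a \<in> C"
      using pref' npref outC unfolding prefers_to_assigned_iff[OF N'A(1)] prefers_to_assigned_iff[OF NA] by blast
    have ta: "(t a, b) \<in> student_less I a"
      using pref' inC[OF aC] unfolding prefers_to_assigned_iff[OF N'A(1)] by blast
    obtain c where c: "(a, c) \<in> N" "c = b \<or> (b, c) \<in> student_less I a"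
      using not_prefersD[OF NA abI npref] by blast
    have "(a, b) \<notin> L" using tf(1)[of a] aC C(1) ta student_asym[OF abI ta] unfolding H_def by blast
    then show ?thesis using c ab aC unfolding L_def by blast
  qed
  \<comment> \<open>Every newcomer is ranked above the student replaced. If \<open>a\<close> wanted
    \<open>b\<close> under \<open>N\<close>, all students of \<open>b\<close> were and remain above
    her. Otherwise \<open>a\<close> was the worst student at \<open>b\<close> and was replaced
    there, so those who stayed and the newcomer are all above her.\<close>
  have "\<not> edge_blocks I (a, b) N'" if ab: "(a, b) \<in> Y" for a b
  proof
    assume bl: "edge_blocks I (a, b) N'"
    have abI: "(a, b) \<in> edges I" using ab YI by blast
    have tr: "trans (school_less I b)" using school_order(1)[OF abI] .
    have pref': "prefers_to_assigned I a b N'" using bl by (simp add: edge_blocks_iff)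
    show False
    proof (cases "prefers_to_assigned I a b N")
      case True
      note full = not_blocksD[OF NA abI True NY[OF ab]]
      obtain x where x: "(x, b) \<in> N'" "(x, a) \<in> school_less I b"
        using bl full(1) N'A(2) by (auto simp: edge_blocks_iff)
      have "(a, x) \<in> school_less I b"
      proof (cases "x \<in> C")
        case xC: True
        then have "b = t x" "(f x, x) \<in> school_less I (t x)" "W (t x) (f x)"
          using inC x tf C(1) by blast+
        then show ?thesis using full(2) transD[OF tr] unfolding W_def by blast
      next
        case False
        then show ?thesis using outC x full(2) by blast
      qed
      then show False using school_asym[OF abI x(2)] by blast
    next
      case False
      then have aC: "a \<in> C" and abN: "(a, b) \<in> N" using new[OF pref' ab] by auto
      then obtain z where z: "z \<in> C" "a = f z" using C(4,6) by (metis imageE)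
      then have zD: "z \<in> D" using C(1) by blast
      then have bz: "b = t z" using z tf(2) abN assigned_unique[OF NA] unfolding W_def by blast
      then have worst: "W b a" and full: "card (students_of N b) = quota I b"
        using tf(2,5) zD z by blast+
      obtain x where x: "(x, b) \<in> N'" "(x, a) \<in> school_less I b"
        using bl full N'A(2) by (auto simp: edge_blocks_iff)
      have "x = a \<or> (a, x) \<in> school_less I b"
      proof (cases "x \<in> C")
        case xC: True
        then have bx: "b = t x" "(f x, x) \<in> school_less I (t x)" "W (t x) (f x)"
          using inC x tf C(1) by blast+
        then have "f x = a" using worst school_asym[OF abI] unfolding W_def by blast
        then show ?thesis using bx by blast
      next
        case False
        then show ?thesis using outC x worst unfolding W_def by blast
      qed
      then show False using school_asym[OF abI x(2)] by blast
    qed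
  qed
  then have "N' \<in> unblocked Y" using N'A(1) unfolding unblocked_def by auto
  moreover have "{(a, b) \<in> Y. prefers_to_assigned I a b N} \<subset> {(a, b) \<in> Y. prefers_to_assigned I a b N'}"
  proof -
    obtain a where a: "a \<in> C" using C(2) by blast
    then obtain c where c: "(a, c) \<in> N" "(t a, c) \<in> student_less I a" using LC unfolding L_def by blast
    have "\<not> prefers_to_assigned I a c N"
      using c(1) NI student_asym unfolding prefers_to_assigned_iff[OF NA] by blast
    moreover have "prefers_to_assigned I a c N'"
      unfolding prefers_to_assigned_iff[OF N'A(1)] using inC[OF a] c(2) by simp
    moreover have "(a, c) \<in> Y" using c(1) NsubY by blast
    ultimately show ?thesis using down by blast
  qed
  moreover have "{(a, b) \<in> Y. prefers_to_assigned I a b N'} \<subseteq> {(a, b) \<in> Y. prefers_to_assigned I a b N} \<union> N"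
    using new by blast
  ultimately show thesis using that by blast
qed

section \<open>Uniqueness of the fixed point\<close>

text \<open>For an edge of \<open>Y\<close> outside \<open>X\<close>, an \<open>N\<close> with the
  smallest \<open>U N\<close> does not have it in \<open>U N\<close>. Among all such
  \<open>N\<close>, take one with \<open>U N\<close> largest. Rotating it downwards adds to
  \<open>U N\<close> only edges of \<open>N\<close>, which lie in \<open>X\<close>, so the missing
  edge is still not added and maximality is violated.\<close>

lemma unblocked_edges_two_cycle:
  assumes XY: "X = unblocked_edges Y" "Y = unblocked_edges X" "X \<subseteq> Y"
  shows "X = Y"
proof (rule ccontr)
  assume "X \<noteq> Y"
  then obtain a b where ab: "(a, b) \<in> Y" "(a, b) \<notin> X" using XY(3) by auto
  define U where "U N = {(a, b) \<in> Y. prefers_to_assigned I a b N}" for N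
  have YI: "Y \<subseteq> edges I" using XY(2) unblocked_edges_subset by blast
  have finU: "finite (U N)" for N
    by (rule finite_subset[OF _ finite_edges]) (use YI in \<open>auto simp: U_def\<close>)
  obtain N0 where "N0 \<in> unblocked Y" using unblocked_nonempty[OF YI] by blast
  then obtain N1 where N1: "N1 \<in> unblocked Y" and
    least: "\<And>N. N \<in> unblocked Y \<Longrightarrow> card (U N1) \<le> card (U N)"
    using ex_has_least_nat[of "\<lambda>N. N \<in> unblocked Y" N0 "\<lambda>N. card (U N)"] by blast
  have "(a, b) \<notin> U N1"
  proof
    assume "(a, b) \<in> U N1"
    then have "prefers_to_assigned I a b N1" unfolding U_def by blast
    then obtain N where "N \<in> unblocked Y" "U N \<subset> U N1"
      using upward_rotation[OF XY N1 ab(1)] unfolding U_def by blast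
    then show False using least psubset_card_mono[OF finU] by (meson not_less)
  qed
  define S where "S = {N \<in> unblocked Y. (a, b) \<notin> U N}"
  have "finite S" unfolding S_def unblocked_def using finite_assignments by simp
  moreover have "S \<noteq> {}" using N1 \<open>(a, b) \<notin> U N1\<close> unfolding S_def by blast
  ultimately obtain N where NS: "N \<in> S" and greatest: "\<And>N'. N' \<in> S \<Longrightarrow> card (U N') \<le> card (U N)"
    using finite_obtain_maximizer[of S "\<lambda>N. card (U N)"] by blast
  then have N: "N \<in> unblocked Y" "\<not> prefers_to_assigned I a b N" using ab unfolding S_def U_def by auto
  have "N \<subseteq> X" using N(1) XY(1) unfolding unblocked_edges_def by blast
  then have nN: "(a, b) \<notin> N" using ab(2) by blast
  obtain N' where N': "N' \<in> unblocked Y" "U N \<subset> U N'" "U N' \<subseteq> U N \<union> N"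
    using downward_rotation[OF XY N(1) ab(1) nN N(2), folded U_def] by blast
  then have "N' \<in> S" using NS nN unfolding S_def by blast
  then show False using greatest psubset_card_mono[OF finU N'(2)] by (meson not_less)
qed

text \<open>The square of an antitone map is monotone and has a least fixed point \<open>X\<close>.
  A fixed point \<open>Z\<close> of the map itself contains \<open>X\<close>, hence is contained in
  the image \<open>Y\<close> of \<open>X\<close>, and \<open>X = Y\<close>.\<close>

lemma ex1_unblocked_edges_fixpoint: "\<exists>!E. E = unblocked_edges E"
proof -
  define F2 where "F2 E = unblocked_edges (unblocked_edges E)" for E
  have mono: "mono F2" by (rule monoI) (simp add: F2_def unblocked_edges_antimono)
  define X where "X = lfp F2"
  define Y where "Y = unblocked_edges X"
  have "X = F2 X" unfolding X_def by (rule lfp_unfold[OF mono])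
  then have X: "X = unblocked_edges Y" unfolding F2_def Y_def .
  have low: "X \<subseteq> E" if "F2 E \<subseteq> E" for E unfolding X_def using that by (rule lfp_lowerbound)
  have "F2 Y = Y" by (simp only: F2_def X[symmetric] Y_def[symmetric])
  then have "X \<subseteq> Y" using low by blast
  then have XY: "X = Y" using unblocked_edges_two_cycle X Y_def by blast
  show ?thesis
  proof (rule ex1I)
    show "X = unblocked_edges X" using X unfolding XY .
  next
    fix Z assume Z: "Z = unblocked_edges Z"
    then have XZ: "X \<subseteq> Z" using low unfolding F2_def by (metis order_refl)
    have "Z \<subseteq> Y" unfolding Y_def by (subst Z) (rule unblocked_edges_antimono[OF XZ])
    then show "Z = X" using XY XZ by blast
  qed
qed

section \<open>Legal sets as stable assignments of a subgraph\<close>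

text \<open>Being blocked by a member of \<open>L\<close> means being blocked by one of its edges,
  so only \<Union>\<open>L\<close> matters.\<close>

lemma legal_property_iff: "legal_property I L \<longleftrightarrow> L = unblocked (\<Union> L)"
  unfolding legal_property_def unblocked_def assignment_blocks_def by auto

text \<open>Taking unions and taking \<open>unblocked\<close> are inverse bijections between legal
  sets and fixed points of \<open>unblocked_edges\<close>.\<close>

lemma ex1_legal_property: "\<exists>!L. legal_property I L"
proof -
  obtain E where E: "E = unblocked_edges E" and uniq: "\<And>E'. E' = unblocked_edges E' \<Longrightarrow> E' = E"
    using ex1_unblocked_edges_fixpoint by metis
  show ?thesis
  proof (rule ex1I)
    show "legal_property I (unblocked E)"
      using E unfolding legal_property_iff unblocked_edges_def by metis
  next
    fix L assume "legal_property I L"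
    then have L: "L = unblocked (\<Union> L)" by (rule iffD1[OF legal_property_iff])
    then have "\<Union> L = unblocked_edges (\<Union> L)" unfolding unblocked_edges_def by (rule arg_cong)
    then show "L = unblocked E" using uniq L by metis
  qed
qed

text \<open>All neighbours compared belong to edges of \<open>E\<close>, so restricting the orders
  changes no comparison.\<close>

lemma edge_blocks_subgraph:
  assumes "M \<subseteq> E" "e \<in> E" "E \<subseteq> edges I"
  shows "edge_blocks (subgraph_instance I E) e M \<longleftrightarrow> edge_blocks I e M"
proof -
  obtain a b where e: "e = (a, b)" by (cases e)
  have "prefers_to_assigned (subgraph_instance I E) a b M \<longleftrightarrow> prefers_to_assigned I a b M"
    using assms e unfolding prefers_to_assigned_def subgraph_instance_def schools_of_def by auto
  then show ?thesis using assms
    unfolding e edge_blocks_def subgraph_instance_def students_of_def by auto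
qed

lemma stable_assignments_subgraph:
  assumes "E \<subseteq> edges I"
  shows "stable_assignments (subgraph_instance I E) = {M \<in> unblocked E. M \<subseteq> E}"
proof -
  have "assignments (subgraph_instance I E) = {M \<in> assignments I. M \<subseteq> E}"
    using assms unfolding assignments_def subgraph_instance_def by auto
  moreover have "edges (subgraph_instance I E) = E" by (simp add: subgraph_instance_def)
  ultimately show ?thesis
    using edge_blocks_subgraph[OF _ _ assms] unfolding stable_assignments_def unblocked_def by auto
qed

end

theorem theorem2:
  fixes I :: "('a, 'b) assignment_instance"
  assumes "stable_assignment_instance I"
  shows "(\<exists>!L. legal_property I L) \<and>
    (\<forall>L. legal_property I L \<longrightarrow>
      (\<exists>E\<^sub>L \<subseteq> edges I.
         L = stable_assignments (subgraph_instance I E\<^sub>L) \<and>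
         E\<^sub>L = \<Union>(stable_assignments (subgraph_instance I E\<^sub>L)) \<and>
         \<Union>(stable_assignments (subgraph_instance I E\<^sub>L)) = \<Union>L))"
proof -
  interpret assignment_problem I by unfold_locales (rule assms)
  have "\<Union>L \<subseteq> edges I \<and> L = stable_assignments (subgraph_instance I (\<Union>L))"
    if "legal_property I L" for L
  proof -
    have L: "L = unblocked (\<Union>L)" using that by (rule iffD1[OF legal_property_iff])
    have sub: "\<Union>L \<subseteq> edges I"
      using that assignments_edges unfolding legal_property_def by blast
    \<comment> \<open>Members of \<open>L\<close> use only edges of \<Union>\<open>L\<close>, so the
      containment demanded by the subgraph holds automatically and \<Union>\<open>L\<close> serves
      as \<open>E\<^sub>L\<close>.\<close>
    have "{M \<in> unblocked (\<Union>L). M \<subseteq> \<Union>L} = L" using L by blast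
    then show ?thesis using sub unfolding stable_assignments_subgraph[OF sub] by (simp only: simp_thms)
  qed
  then show ?thesis using ex1_legal_property by metis
qed

end
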